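(* Let $T$ be a random variable with $0\le T\le1$ a.s., let $T_1,T_2,\ldots$ be an i.i.d. sample of $T$, and let $\{M_k^{\mu,-}\}_{k\ge0,\,\mu>0}$ and $\{M_k^{\mu,+}\}_{k\ge0,\,\mu<1}$ be a decreasing, respectively increasing, family of test supermartingales for the null hypotheses $\{H_0:\mathbf{E}(T)\le\mu\}_\mu$, respectively $\{H_0:\mathbf{E}(T)\ge\mu\}_\mu$, with $M_0^{\mu,-}=M_0^{\mu,+}=1$. Let $0<\alpha^+<1$ and $0<\alpha^-<1$. For $k\ge0$ let $$B_k^l=-\infty\text{ if }M_k^{\mu,-}<1/\alpha^-\text{ for all }\mu>0,\qquad B_k^l=\sup\{\mu>0\mid M_k^{\mu,-}\ge1/\alpha^-\}\text{ otherwise},$$ $$B_k^u=\infty\text{ if }M_k^{\mu,+}<1/\alpha^+\text{ for all }\mu<1,\qquad B_k^u=\inf\{\mu<1\mid M_k^{\mu,+}\ge1/\alpha^+\}\text{ otherwise}.$$ Then for every $k$ the interval $\left(\max_{i\le k}B_i^l,\ \min_{i\le k}B_i^u\right)$ is a $(1-\alpha^+-\alpha^-)$-confidence interval for $\mathbf{E}(T)$, i.e. it contains $\mathbf{E}(T)$ with probability at least $1-\alpha^+-\alpha^-$. If the two families are the integrated families $$M_k^{\mu,-}=\int_0^1\prod_{i=1}^k\left((1-c)+c\,\frac{T_i}{\mu}\right)\pi^-(c)\,dc,\qquad M_k^{\mu,+}=\int_0^1\prod_{i=1}^k\left((1-c)+c\,\frac{1-T_i}{1-\mu}\right)\pi^+(c)\,dc,$$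 where $\pi^-,\pi^+$ are probability densities on $[0,1]$ (chosen independently of the sample), then $B_k^l<\overline{t}_k<B_k^u$ for all $k\ge1$, where $\overline{t}_k=\frac1k\sum_{i=1}^kT_i$.
   Context: A filtration $\{\mathcal{F}_k\}_{k\ge0}$ is fixed such that $T_k$ is $\mathcal{F}_k$-measurable and independent of $\mathcal{F}_{k-1}$ for $k\ge1$. A process $\{Y_k\}_{k\ge0}$ is a test supermartingale for a hypothesis $H_0$ if, whenever $H_0$ is satisfied, $\{Y_k\}_k$ is a positive (i.e. $Y_k\ge0$ a.s. for each $k$) integrable supermartingale with respect to $\{\mathcal{F}_k\}_k$ with $\mathbf{E}(Y_0)>0$. A decreasing family of test supermartingales for $\{H_0:\mathbf{E}(T)\le\mu\}_\mu$ is a family $\{M_k^{\mu}\}_{k\ge0,\mu>0}$ such that for each $\mu>0$, $\{M_k^\mu\}_k$ is a test supermartingale for $H_0:\mathbf{E}(T)\le\mu$, and for each $k$ every realization of $\mu\mapsto M_k^\mu$ is continuous and decreasing (nonincreasing) on $(0,\infty)$. An increasing family of test supermartingales for $\{H_0:\mathbf{E}(T)\ge\mu\}_\mu$ is a family $\{M_k^\mu\}_{k\ge0,\mu<1}$ such that for each $\mu<1$, $\{M_k^\mu\}_k$ is a test supermartingale for $H_0:\mathbf{E}(T)\ge\mu$, and for each $k$ every realization of $\mu\mapsto M_k^\mu$ is continuous and increasing (nondecreasing) on $(-\infty,1)$. An open interval $(a,b)$ with $a\ge b$ is empty; endpoints may be $\pm\infty$. *)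

theory Defs
  imports "HOL-Probability.Probability"
begin

text \<open>Samples are indexed from 1; \<open>Ts 0\<close> is never used.\<close>

definition iid_sample :: "'a measure \<Rightarrow> ('a \<Rightarrow> real) \<Rightarrow> (nat \<Rightarrow> 'a \<Rightarrow> real) \<Rightarrow> bool" where
  "iid_sample P T Ts \<longleftrightarrow>
     prob_space.indep_vars P (\<lambda>_. borel) Ts {1..} \<and>
     (\<forall>k\<ge>1. distr P borel (Ts k) = distr P borel T)"

definition sample_filtration :: "'a measure \<Rightarrow> (nat \<Rightarrow> 'a measure) \<Rightarrow> (nat \<Rightarrow> 'a \<Rightarrow> real) \<Rightarrow> bool" where
  "sample_filtration P F Ts \<longleftrightarrow>
     filtration (space P) F \<and> (\<forall>k. subalgebra P (F k)) \<and>
     (\<forall>k\<ge>1. Ts k \<in> borel_measurable (F k) \<and>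
        prob_space.indep_set P (sets (vimage_algebra (space P) (Ts k) borel)) (sets (F (k - 1))))"

definition supermartingale :: "'a measure \<Rightarrow> (nat \<Rightarrow> 'a measure) \<Rightarrow> (nat \<Rightarrow> 'a \<Rightarrow> real) \<Rightarrow> bool" where
  "supermartingale P F Y \<longleftrightarrow>
     (\<forall>k. Y k \<in> borel_measurable (F k) \<and> integrable P (Y k)) \<and>
     (\<forall>i j. i \<le> j \<longrightarrow> (AE \<omega> in P. real_cond_exp P (F i) (Y j) \<omega> \<le> Y i \<omega>))"

text \<open>A hypothesis is a proposition \<open>H\<^sub>0\<close> about the fixed probability space; nothing is required
  of the process when \<open>H\<^sub>0\<close> fails.\<close>

definition test_supermartingale ::
    "'a measure \<Rightarrow> (nat \<Rightarrow> 'a measure) \<Rightarrow> bool \<Rightarrow> (nat \<Rightarrow> 'a \<Rightarrow> real) \<Rightarrow> bool" where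
  "test_supermartingale P F H\<^sub>0 Y \<longleftrightarrow>
     (H\<^sub>0 \<longrightarrow> (\<forall>k. AE \<omega> in P. 0 \<le> Y k \<omega>) \<and> supermartingale P F Y \<and>
            0 < prob_space.expectation P (Y 0))"

text \<open>Families are written \<open>M \<mu> k \<omega>\<close>. Values for \<open>\<mu>\<close> outside \<open>(0, \<infinity>)\<close> (decreasing case) or
  outside \<open>(-\<infinity>, 1)\<close> (increasing case) are irrelevant here and below.\<close>

definition decreasing_test_family ::
    "'a measure \<Rightarrow> (nat \<Rightarrow> 'a measure) \<Rightarrow> ('a \<Rightarrow> real) \<Rightarrow> (real \<Rightarrow> nat \<Rightarrow> 'a \<Rightarrow> real) \<Rightarrow> bool" where
  "decreasing_test_family P F T M \<longleftrightarrow>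
     (\<forall>\<mu>>0. test_supermartingale P F (prob_space.expectation P T \<le> \<mu>) (M \<mu>)) \<and>
     (\<forall>k. \<forall>\<omega>\<in>space P. continuous_on {0<..} (\<lambda>\<mu>. M \<mu> k \<omega>) \<and> antimono_on {0<..} (\<lambda>\<mu>. M \<mu> k \<omega>))"

definition increasing_test_family ::
    "'a measure \<Rightarrow> (nat \<Rightarrow> 'a measure) \<Rightarrow> ('a \<Rightarrow> real) \<Rightarrow> (real \<Rightarrow> nat \<Rightarrow> 'a \<Rightarrow> real) \<Rightarrow> bool" where
  "increasing_test_family P F T M \<longleftrightarrow>
     (\<forall>\<mu><1. test_supermartingale P F (prob_space.expectation P T \<ge> \<mu>) (M \<mu>)) \<and>
     (\<forall>k. \<forall>\<omega>\<in>space P. continuous_on {..<1} (\<lambda>\<mu>. M \<mu> k \<omega>) \<and> mono_on {..<1} (\<lambda>\<mu>. M \<mu> k \<omega>))"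

definition lower_bound :: "(real \<Rightarrow> nat \<Rightarrow> 'a \<Rightarrow> real) \<Rightarrow> real \<Rightarrow> nat \<Rightarrow> 'a \<Rightarrow> ereal" where
  "lower_bound M \<alpha> k \<omega> =
     (if \<forall>\<mu>>0. M \<mu> k \<omega> < 1 / \<alpha> then -\<infinity> else Sup (ereal ` {\<mu>. 0 < \<mu> \<and> M \<mu> k \<omega> \<ge> 1 / \<alpha>}))"

definition upper_bound :: "(real \<Rightarrow> nat \<Rightarrow> 'a \<Rightarrow> real) \<Rightarrow> real \<Rightarrow> nat \<Rightarrow> 'a \<Rightarrow> ereal" where
  "upper_bound M \<alpha> k \<omega> =
     (if \<forall>\<mu><1. M \<mu> k \<omega> < 1 / \<alpha> then \<infinity> else Inf (ereal ` {\<mu>. \<mu> < 1 \<and> M \<mu> k \<omega> \<ge> 1 / \<alpha>}))"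

text \<open>Measurability of the coverage event is part of the definition, since \<open>measure\<close> is 0 on
  non-measurable sets and a non-positive level \<open>\<gamma>\<close> would then be vacuous.\<close>

definition confidence_interval ::
    "'a measure \<Rightarrow> real \<Rightarrow> ('a \<Rightarrow> ereal set) \<Rightarrow> real \<Rightarrow> bool" where
  "confidence_interval P \<gamma> I \<theta> \<longleftrightarrow>
     {\<omega> \<in> space P. ereal \<theta> \<in> I \<omega>} \<in> sets P \<and>
     measure P {\<omega> \<in> space P. ereal \<theta> \<in> I \<omega>} \<ge> \<gamma>"

definition density_on_unit_interval :: "(real \<Rightarrow> real) \<Rightarrow> bool" where
  "density_on_unit_interval p \<longleftrightarrow>
     (\<forall>c\<in>{0..1}. 0 \<le> p c) \<and> set_integrable lborel {0..1} p \<and> (LBINT c:{0..1}. p c) = 1"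

definition integrated_decreasing ::
    "(nat \<Rightarrow> 'a \<Rightarrow> real) \<Rightarrow> (real \<Rightarrow> real) \<Rightarrow> real \<Rightarrow> nat \<Rightarrow> 'a \<Rightarrow> real" where
  "integrated_decreasing Ts p \<mu> k \<omega> =
     (LBINT c:{0..1}. (\<Prod>i=1..k. (1 - c) + c * (Ts i \<omega> / \<mu>)) * p c)"

definition integrated_increasing ::
    "(nat \<Rightarrow> 'a \<Rightarrow> real) \<Rightarrow> (real \<Rightarrow> real) \<Rightarrow> real \<Rightarrow> nat \<Rightarrow> 'a \<Rightarrow> real" where
  "integrated_increasing Ts p \<mu> k \<omega> =
     (LBINT c:{0..1}. (\<Prod>i=1..k. (1 - c) + c * ((1 - Ts i \<omega>) / (1 - \<mu>))) * p c)"

definition sample_mean :: "(nat \<Rightarrow> 'a \<Rightarrow> real) \<Rightarrow> nat \<Rightarrow> 'a \<Rightarrow> real" where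
  "sample_mean Ts k \<omega> = (\<Sum>i=1..k. Ts i \<omega>) / real k"

end

theory Submission
  imports Defs
begin

text \<open>By continuity and monotonicity in \<open>\<mu>\<close>, the bound \<open>B\<^sub>k\<^sup>l\<close> misses \<open>m = E(T) > 0\<close> exactly when
  \<open>M\<^sub>k\<^sup>m \<ge> 1/\<alpha>\<close>, so Ville's inequality bounds the probability of ever missing by \<open>\<alpha>\<close>. For \<open>m = 0\<close>
  the family has no member at \<open>m\<close>, and the event is the increasing limit of the events for
  \<open>\<mu> = 1/n\<close>. In the integrated case \<open>1 + x \<le> exp x\<close> shows that the betting product at
  \<open>\<mu> = \<close> sample mean is at most 1, which is below \<open>1/\<alpha>\<close>. The upper bound is the lower bound of the
  family reflected by \<open>\<mu> \<mapsto> 1 - \<mu>\<close>, \<open>T \<mapsto> 1 - T\<close>.\<close>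

section \<open>Mixtures of betting products\<close>

text \<open>A form of the AM-GM inequality: for a nonempty finite index set the factors are
  nonnegative and average to 1. With exponential bounds on the factors, \<open>mean\<close> makes
  the exponents sum to zero.\<close>

lemma prod_betting_le_one:
  fixes x :: "'i \<Rightarrow> real"
  assumes c: "c \<in> {0..1}" and t: "0 < t"
    and x: "\<And>i. i \<in> I \<Longrightarrow> 0 \<le> x i" and mean: "(\<Sum>i\<in>I. x i) = t * real (card I)"
  shows "(\<Prod>i\<in>I. (1 - c) + c * (x i / t)) \<le> 1"
proof (cases "finite I")
  case True
  have "(\<Prod>i\<in>I. (1 - c) + c * (x i / t)) \<le> (\<Prod>i\<in>I. exp (c * (x i / t - 1)))"
  proof (rule prod_mono)
    fix i assume "i \<in> I"
    have "1 + c * (x i / t - 1) \<le> exp (c * (x i / t - 1))" by simp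
    moreover have "0 \<le> (1 - c) + c * (x i / t)"
      using c t x[OF \<open>i \<in> I\<close>] by (intro add_nonneg_nonneg mult_nonneg_nonneg) auto
    ultimately show "0 \<le> (1 - c) + c * (x i / t) \<and> (1 - c) + c * (x i / t) \<le> exp (c * (x i / t - 1))"
      by (simp add: algebra_simps)
  qed
  also have "\<dots> = exp (c * ((\<Sum>i\<in>I. x i) / t - real (card I)))"
    using True by (simp add: exp_sum[symmetric] sum_distrib_left[symmetric] sum_subtractf
        sum_divide_distrib[symmetric])
  also have "\<dots> = 1" using t by (simp add: mean)
  finally show ?thesis .
\<comment> \<open>Over an infinite index set the product is 1 by convention.\<close>
qed simp

lemma density_integral_le_one:
  assumes "density_on_unit_interval p"
    and "\<And>c. c \<in> {0..1} \<Longrightarrow> g c \<le> 1"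
  shows "(LBINT c:{0..1}. g c * p c) \<le> 1"
proof -
  have "(LBINT c:{0..1}. g c * p c) \<le> (LBINT c:{0..1}. p c)"
    unfolding set_lebesgue_integral_def
  \<comment> \<open>This rule asks for integrability of the larger function only: a non-integrable
    smaller one would have integral 0, which the nonnegativity goal covers.\<close>
  proof (rule integral_mono')
    show "integrable lborel (\<lambda>c. indicat_real {0..1} c *\<^sub>R p c)"
      using assms(1) by (simp add: density_on_unit_interval_def set_integrable_def)
    show "indicat_real {0..1} c *\<^sub>R (g c * p c) \<le> indicat_real {0..1} c *\<^sub>R p c" for c
      using assms by (auto simp: density_on_unit_interval_def indicator_def mult_left_le_one_le
          intro: mult_right_mono[of "g c" 1 "p c", simplified])
    show "0 \<le> indicat_real {0..1} c *\<^sub>R p c" for c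
      using assms by (auto simp: density_on_unit_interval_def indicator_def)
  qed
  then show ?thesis using assms(1) by (simp add: density_on_unit_interval_def)
qed

section \<open>The lower bound compared with a threshold\<close>

text \<open>A supremum could equal \<open>m\<close> without being attained. Continuity excludes this
  by keeping the value below the level slightly to the left of \<open>m\<close>, and monotonicity
  extends that to everything further right.\<close>

lemma lower_bound_less_pos_iff:
  assumes cont: "continuous_on {0<..} (\<lambda>\<mu>. M \<mu> k \<omega>)" and anti: "antimono_on {0<..} (\<lambda>\<mu>. M \<mu> k \<omega>)"
    and m: "0 < m"
  shows "lower_bound M \<alpha> k \<omega> < ereal m \<longleftrightarrow> M m k \<omega> < 1 / \<alpha>"
proof
  assume l: "lower_bound M \<alpha> k \<omega> < ereal m"
  show "M m k \<omega> < 1 / \<alpha>"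
  proof (rule ccontr)
    assume n: "\<not> M m k \<omega> < 1 / \<alpha>"
    then have "lower_bound M \<alpha> k \<omega> = Sup (ereal ` {\<mu>. 0 < \<mu> \<and> M \<mu> k \<omega> \<ge> 1 / \<alpha>})"
      using m by (auto simp: lower_bound_def)
    moreover have "ereal m \<le> Sup (ereal ` {\<mu>. 0 < \<mu> \<and> M \<mu> k \<omega> \<ge> 1 / \<alpha>})"
      using m n by (intro Sup_upper) auto
    ultimately show False using l by simp
  qed
next
  assume l: "M m k \<omega> < 1 / \<alpha>"
  have "isCont (\<lambda>\<mu>. M \<mu> k \<omega>) m"
    using cont m by (simp add: continuous_on_eq_continuous_at)
  then have "\<forall>\<^sub>F \<mu> in at m. M \<mu> k \<omega> < 1 / \<alpha>"
    using l by (auto simp: isCont_def dest: order_tendstoD)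
  then have "\<forall>\<^sub>F \<mu> in at_left m. M \<mu> k \<omega> < 1 / \<alpha>"
    by (simp add: eventually_at_split)
  moreover have "\<forall>\<^sub>F \<mu> in at_left m. \<mu> \<in> {0<..<m}"
    using m by (rule eventually_at_left_real)
  ultimately have "\<forall>\<^sub>F \<mu> in at_left m. M \<mu> k \<omega> < 1 / \<alpha> \<and> \<mu> \<in> {0<..<m}"
    by eventually_elim simp
  \<comment> \<open>This \<open>d\<close> bounds the superlevel set from above; its gap to
    \<open>m\<close> makes the inequality strict.\<close>
  then obtain d where d: "M d k \<omega> < 1 / \<alpha>" "0 < d" "d < m"
    using eventually_happens'[of "at_left m"] by auto
  have "\<mu> \<le> d" if "0 < \<mu>" "M \<mu> k \<omega> \<ge> 1 / \<alpha>" for \<mu>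
  proof (rule ccontr)
    assume "\<not> \<mu> \<le> d"
    then have "M \<mu> k \<omega> \<le> M d k \<omega>"
      using anti d by (auto simp: monotone_on_def)
    with that d show False by simp
  qed
  then have "lower_bound M \<alpha> k \<omega> \<le> ereal d"
    by (auto simp: lower_bound_def intro!: Sup_least)
  also have "\<dots> < ereal m" using d by simp
  finally show "lower_bound M \<alpha> k \<omega> < ereal m" .
qed

text \<open>Replaces the previous criterion at 0, where the family has no member. A supremum over a
  nonempty set of positive numbers is never negative, so only the default value
  \<open>-\<infinity>\<close> lies below 0.\<close>

lemma lower_bound_less_zero_iff:
  "lower_bound M \<alpha> k \<omega> < 0 \<longleftrightarrow> (\<forall>\<mu>>0. M \<mu> k \<omega> < 1 / \<alpha>)"
proof
  assume l: "lower_bound M \<alpha> k \<omega> < 0"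
  show "\<forall>\<mu>>0. M \<mu> k \<omega> < 1 / \<alpha>"
  proof (rule ccontr)
    assume n: "\<not> (\<forall>\<mu>>0. M \<mu> k \<omega> < 1 / \<alpha>)"
    then obtain \<mu> where \<mu>: "0 < \<mu>" "M \<mu> k \<omega> \<ge> 1 / \<alpha>" by (auto simp: not_less)
    have "0 \<le> ereal \<mu>" using \<mu> by simp
    also have "\<dots> \<le> Sup (ereal ` {\<mu>. 0 < \<mu> \<and> M \<mu> k \<omega> \<ge> 1 / \<alpha>})"
      using \<mu> by (intro Sup_upper) auto
    also have "\<dots> = lower_bound M \<alpha> k \<omega>"
      using n by (simp only: lower_bound_def if_False)
    finally show False using l by simp
  qed
qed (simp add: lower_bound_def)

section \<open>Reflection of the increasing case to the decreasing one\<close>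

text \<open>Reflection exchanges infimum and supremum when the superlevel set is nonempty; otherwise
  the two default values correspond.\<close>

lemma upper_bound_reflect:
  "upper_bound M \<alpha> k \<omega> = 1 - lower_bound (\<lambda>\<mu>. M (1 - \<mu>)) \<alpha> k \<omega>"
proof -
  define S where "S = {\<mu>. 0 < \<mu> \<and> M (1 - \<mu>) k \<omega> \<ge> 1 / \<alpha>}"
  have img: "{\<mu>. \<mu> < 1 \<and> M \<mu> k \<omega> \<ge> 1 / \<alpha>} = (\<lambda>\<mu>. 1 - \<mu>) ` S"
    by (auto simp: S_def image_iff intro!: exI[of _ "1 - _"])
  have ex: "(\<forall>\<mu><1. M \<mu> k \<omega> < 1 / \<alpha>) \<longleftrightarrow> S = {}"
    using img by (auto simp: not_le[symmetric])
  have ex': "(\<forall>\<mu>>0. M (1 - \<mu>) k \<omega> < 1 / \<alpha>) \<longleftrightarrow> S = {}"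
    by (auto simp: S_def not_le[symmetric])
  have "(INF \<mu>\<in>S. 1 - ereal \<mu>) = 1 - (SUP \<mu>\<in>S. ereal \<mu>)" if "S \<noteq> {}"
    using that by (intro INF_ereal_minus_right) auto
  then show ?thesis
    unfolding upper_bound_def lower_bound_def ex ex' img S_def[symmetric]
    by (auto simp: image_image one_ereal_def)
qed

text \<open>By linearity of expectation, which uses integrability of \<open>T\<close>, the reflected
  null hypothesis is the same proposition as the original one, so the supermartingale property
  carries over unchanged.\<close>

lemma increasing_test_family_reflect:
  assumes "prob_space P" "integrable P T" "increasing_test_family P F T M"
  shows "decreasing_test_family P F (\<lambda>\<omega>. 1 - T \<omega>) (\<lambda>\<mu>. M (1 - \<mu>))"
proof -
  interpret prob_space P by fact
  have "expectation (\<lambda>\<omega>. 1 - T \<omega>) \<le> \<mu> \<longleftrightarrow> 1 - \<mu> \<le> expectation T" for \<mu>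
    using assms(2) by (auto simp: prob_space)
  moreover have "continuous_on {0<..} (\<lambda>\<mu>. M (1 - \<mu>) k \<omega>)"
    "antimono_on {0<..} (\<lambda>\<mu>. M (1 - \<mu>) k \<omega>)" if "\<omega> \<in> space P" for k \<omega>
  proof -
    have c: "continuous_on {..<1} (\<lambda>\<mu>. M \<mu> k \<omega>)" "mono_on {..<1} (\<lambda>\<mu>. M \<mu> k \<omega>)"
      using assms(3) that by (auto simp: increasing_test_family_def)
    show "continuous_on {0<..} (\<lambda>\<mu>. M (1 - \<mu>) k \<omega>)"
      by (rule continuous_on_compose2[OF c(1)]) (auto intro!: continuous_intros)
    show "antimono_on {0<..} (\<lambda>\<mu>. M (1 - \<mu>) k \<omega>)"
      using c(2) by (auto simp: monotone_on_def)
  qed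
  ultimately show ?thesis
    using assms(3) by (auto simp: decreasing_test_family_def increasing_test_family_def)
qed

section \<open>Ville's inequality up to a finite time\<close>

text \<open>On events of the past, \<open>Y j\<close> may be replaced under the integral by its
  conditional expectation, which is at most \<open>Y i\<close> almost surely.\<close>

lemma supermartingale_set_integral_mono:
  assumes "prob_space P" and sub: "subalgebra P (F i)" and Y: "supermartingale P F Y"
    and "i \<le> j" and A: "A \<in> sets (F i)"
  shows "(LINT \<omega>:A|P. Y j \<omega>) \<le> (LINT \<omega>:A|P. Y i \<omega>)"
proof -
  interpret prob_space P by fact
  interpret finite_measure_subalgebra P "F i" by unfold_locales (rule sub)
  have A': "A \<in> sets P" using A sub by (auto simp: subalgebra_def)
  have int: "integrable P (Y n)" for n using Y by (simp add: supermartingale_def)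
  have "(LINT \<omega>:A|P. Y j \<omega>) = (LINT \<omega>:A|P. real_cond_exp P (F i) (Y j) \<omega>)"
    by (rule real_cond_exp_intA[OF int A])
  also have "\<dots> \<le> (LINT \<omega>:A|P. Y i \<omega>)"
    unfolding set_lebesgue_integral_def
  proof (rule integral_mono_AE)
    show "integrable P (\<lambda>\<omega>. indicat_real A \<omega> *\<^sub>R real_cond_exp P (F i) (Y j) \<omega>)"
      by (intro integrable_mult_indicator A' real_cond_exp_int int)
    show "integrable P (\<lambda>\<omega>. indicat_real A \<omega> *\<^sub>R Y i \<omega>)"
      by (intro integrable_mult_indicator A' int)
    have "AE \<omega> in P. real_cond_exp P (F i) (Y j) \<omega> \<le> Y i \<omega>"
      using Y \<open>i \<le> j\<close> by (simp add: supermartingale_def)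
    then show "AE \<omega> in P. indicat_real A \<omega> *\<^sub>R real_cond_exp P (F i) (Y j) \<omega>
        \<le> indicat_real A \<omega> *\<^sub>R Y i \<omega>"
      by eventually_elim (auto simp: indicator_def)
  qed
  finally show ?thesis .
qed

text \<open>Optional stopping at the first time the level \<open>c\<close> is reached, carried out
  by induction on the horizon.\<close>

lemma ville_inequality:
  assumes "prob_space P" and filt: "filtration (space P) F" and sub: "\<And>i. subalgebra P (F i)"
    and Y: "supermartingale P F Y" and pos: "\<And>i. AE \<omega> in P. 0 \<le> Y i \<omega>"
  shows "{\<omega> \<in> space P. \<exists>i\<le>k. c \<le> Y i \<omega>} \<in> sets P"
    and "c * measure P {\<omega> \<in> space P. \<exists>i\<le>k. c \<le> Y i \<omega>} \<le> prob_space.expectation P (Y 0)"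
proof -
  interpret prob_space P by fact
  interpret filtration "space P" F by fact
  \<comment> \<open>If tau is the first time the level is reached, the three events are tau > n, tau
    = n and tau <= n.\<close>
  define N where "N n = {\<omega> \<in> space P. \<forall>i\<le>n. Y i \<omega> < c}" for n
  define A where "A n = {\<omega> \<in> space P. (\<forall>i<n. Y i \<omega> < c) \<and> c \<le> Y n \<omega>}" for n
  define U where "U n = {\<omega> \<in> space P. \<exists>i\<le>n. c \<le> Y i \<omega>}" for n
  have int: "integrable P (Y n)" for n using Y by (simp add: supermartingale_def)
  note [measurable] = borel_measurable_integrable[OF int]
  have [measurable]: "N n \<in> sets P" "A n \<in> sets P" "U n \<in> sets P" for n
    unfolding N_def A_def U_def by measurable
  \<comment> \<open>The supermartingale inequality from \<open>n\<close> to \<open>Suc n\<close> can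
    be integrated over \<open>N n\<close> only because this event is already decided at time
    \<open>n\<close>.\<close>
  have NF: "N n \<in> sets (F n)" for n
  proof -
    have [measurable]: "Y i \<in> borel_measurable (F n)" if "i \<le> n" for i
    proof -
      have "subalgebra (F n) (F i)"
        using sets_F_mono[OF that] by (simp add: subalgebra_def space_F)
      then show ?thesis
        using Y by (auto simp: supermartingale_def intro: measurable_from_subalg)
    qed
    have "N n = {\<omega> \<in> space (F n). \<forall>i\<in>{..n}. Y i \<omega> < c}" by (auto simp: N_def space_F)
    also have "\<dots> \<in> sets (F n)" by (intro sets.sets_Collect_finite_All) (auto intro: borel_measurable_less)
    finally show ?thesis .
  qed
  have sint: "set_integrable P B (Y n)" if "B \<in> sets P" for B n
    unfolding set_integrable_def by (intro integrable_mult_indicator that int)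
  have markov: "c * prob (A n) \<le> (LINT \<omega>:A n|P. Y n \<omega>)" for n
  proof -
    have "c * prob (A n) = (LINT \<omega>:A n|P. c)" by (simp add: set_lebesgue_integral_def)
    also have "\<dots> \<le> (LINT \<omega>:A n|P. Y n \<omega>)"
    proof (rule set_integral_mono)
      show "set_integrable P (A n) (\<lambda>_. c)"
        unfolding set_integrable_def by (intro integrable_mult_indicator) auto
    qed (auto simp: sint, auto simp: A_def)
    finally show ?thesis .
  qed
  \<comment> \<open>The left side bounds from below the expectation of the process stopped at the
    first crossing, since the stopped value is at least \<open>c\<close> on
    \<open>U n\<close>.\<close>
  have step: "c * prob (U n) + (LINT \<omega>:N n|P. Y n \<omega>) \<le> expectation (Y 0)" for n
  proof (induction n)
    case 0
    have "expectation (Y 0) = (LINT \<omega>:A 0 \<union> N 0|P. Y 0 \<omega>)"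
      unfolding set_lebesgue_integral_def
      by (rule Bochner_Integration.integral_cong) (auto simp: A_def N_def indicator_def)
    also have "\<dots> = (LINT \<omega>:A 0|P. Y 0 \<omega>) + (LINT \<omega>:N 0|P. Y 0 \<omega>)"
      by (rule set_integral_Un) (auto simp: sint, auto simp: A_def N_def)
    moreover have "U 0 = A 0" by (auto simp: U_def A_def)
    ultimately show ?case using markov[of 0] by simp
  next
    case (Suc n)
    \<comment> \<open>Paths in \<open>N n\<close> either cross at \<open>Suc n\<close> or stay
      below. The first part is turned into probability by \<open>markov\<close> and added to
      \<open>U n\<close>.\<close>
    have "(LINT \<omega>:N n|P. Y n \<omega>) \<ge> (LINT \<omega>:N n|P. Y (Suc n) \<omega>)"
      by (rule supermartingale_set_integral_mono[OF \<open>prob_space P\<close> sub Y _ NF]) simp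
    moreover have "N n = A (Suc n) \<union> N (Suc n)"
      by (auto simp: A_def N_def less_Suc_eq_le le_Suc_eq not_le)
    moreover have "(LINT \<omega>:A (Suc n) \<union> N (Suc n)|P. Y (Suc n) \<omega>)
        = (LINT \<omega>:A (Suc n)|P. Y (Suc n) \<omega>) + (LINT \<omega>:N (Suc n)|P. Y (Suc n) \<omega>)"
      by (rule set_integral_Un) (auto simp: sint, auto simp: A_def N_def)
    moreover have "prob (U (Suc n)) = prob (U n) + prob (A (Suc n))"
    proof -
      have "U (Suc n) = U n \<union> A (Suc n)"
        by (auto simp: U_def A_def less_Suc_eq_le le_Suc_eq)
      moreover have "U n \<inter> A (Suc n) = {}" by (auto simp: U_def A_def less_Suc_eq_le not_le[symmetric])
      ultimately show ?thesis by (simp add: finite_measure_Union)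
    qed
    ultimately show ?case using Suc.IH markov[of "Suc n"] by (simp add: algebra_simps)
  qed
  \<comment> \<open>Nonnegativity allows the contribution of the uncrossed paths to be
    dropped.\<close>
  have "0 \<le> (LINT \<omega>:N k|P. Y k \<omega>)"
    unfolding set_lebesgue_integral_def
    by (rule integral_nonneg_AE) (use pos[of k] in \<open>eventually_elim, simp\<close>)
  with step[of k] show "c * prob {\<omega> \<in> space P. \<exists>i\<le>k. c \<le> Y i \<omega>} \<le> expectation (Y 0)"
    by (simp add: U_def)
  show "{\<omega> \<in> space P. \<exists>i\<le>k. c \<le> Y i \<omega>} \<in> sets P" by measurable
qed

section \<open>Probability that the lower bound misses the mean\<close>

text \<open>The confidence interval is open, so a bound equal to the mean counts as a miss; hence
  the nonstrict inequality in \<open>B\<close>.\<close>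

lemma lower_noncoverage:
  fixes k :: nat
  assumes "prob_space P" and filt: "filtration (space P) F" and sub: "\<And>i. subalgebra P (F i)"
    and fam: "decreasing_test_family P F T M"
    and start: "\<forall>\<mu>>0. AE \<omega> in P. M \<mu> 0 \<omega> = 1"
    and \<alpha>: "0 < \<alpha>" and nonneg: "0 \<le> prob_space.expectation P T"
  defines "B \<equiv> {\<omega> \<in> space P. \<exists>i\<le>k. ereal (prob_space.expectation P T) \<le> lower_bound M \<alpha> i \<omega>}"
  shows "B \<in> sets P" "measure P B \<le> \<alpha>"
proof -
  interpret prob_space P by fact
  define m where "m = expectation T"
  define E where "E \<mu> = {\<omega> \<in> space P. \<exists>i\<le>k. 1 / \<alpha> \<le> M \<mu> i \<omega>}" for \<mu>
  \<comment> \<open>The null hypothesis is true for every \<open>\<mu>\<close> from \<open>m\<close>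
    upwards, so Ville's inequality applies with initial expectation 1 and level
    \<open>1 / \<alpha>\<close>.\<close>
  have E: "E \<mu> \<in> sets P \<and> prob (E \<mu>) \<le> \<alpha>" if "0 < \<mu>" "m \<le> \<mu>" for \<mu>
  proof -
    have t: "supermartingale P F (M \<mu>)" "AE \<omega> in P. 0 \<le> M \<mu> i \<omega>" for i
      using fam that by (auto simp: decreasing_test_family_def test_supermartingale_def m_def)
    note v = ville_inequality[OF \<open>prob_space P\<close> filt sub t, where k = k and c = "1 / \<alpha>", folded E_def]
    have "expectation (M \<mu> 0) = expectation (\<lambda>_. 1)"
      using start that t by (intro integral_cong_AE) (auto simp: supermartingale_def)
    then have "1 / \<alpha> * prob (E \<mu>) \<le> 1" using v(2) by (simp add: prob_space)
    then show ?thesis using v(1) \<alpha> by (simp add: field_simps)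
  qed
  have fam': "continuous_on {0<..} (\<lambda>\<mu>. M \<mu> i \<omega>)" "antimono_on {0<..} (\<lambda>\<mu>. M \<mu> i \<omega>)"
    if "\<omega> \<in> space P" for i \<omega>
    using fam that by (auto simp: decreasing_test_family_def)
  have "B \<in> sets P \<and> prob B \<le> \<alpha>"
  proof (cases "m = 0")
    case False
    then have "0 < m" using nonneg by (simp add: m_def)
    then have "B = E m"
      unfolding B_def E_def m_def[symmetric] using lower_bound_less_pos_iff[where M = M and m = m and \<alpha> = \<alpha>, OF fam']
      by (auto simp: not_less[symmetric])
    then show ?thesis using E \<open>0 < m\<close> by simp
  next
    case True
    have EN: "E (inverse (Suc n)) \<in> sets P" "prob (E (inverse (Suc n))) \<le> \<alpha>" for n
      using E[of "inverse (real (Suc n))"] True by auto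
    have le: "E \<mu> \<subseteq> E \<mu>'" if "0 < \<mu>'" "\<mu>' \<le> \<mu>" for \<mu> \<mu>'
    proof
      fix \<omega> assume "\<omega> \<in> E \<mu>"
      then obtain i where i: "\<omega> \<in> space P" "i \<le> k" "1 / \<alpha> \<le> M \<mu> i \<omega>" by (auto simp: E_def)
      then have "M \<mu> i \<omega> \<le> M \<mu>' i \<omega>" using fam'(2)[of \<omega> i] that by (auto simp: monotone_on_def)
      then show "\<omega> \<in> E \<mu>'" using i unfolding E_def by (auto intro: order_trans)
    qed
    have "ereal 0 \<le> lower_bound M \<alpha> i \<omega> \<longleftrightarrow> (\<exists>\<mu>>0. 1 / \<alpha> \<le> M \<mu> i \<omega>)" for i \<omega>
      using lower_bound_less_zero_iff[of M \<alpha> i \<omega>]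
      by (simp add: not_less[symmetric] zero_ereal_def[symmetric])
    then have "B = (\<Union>\<mu>\<in>{0<..}. E \<mu>)"
      unfolding B_def E_def m_def[symmetric] True by auto
    \<comment> \<open>By monotonicity in \<open>\<mu>\<close> the uncountable union reduces to an
      increasing sequence, which yields both measurability and the limit of the
      probabilities.\<close>
    also have "\<dots> = (\<Union>n. E (inverse (Suc n)))"
    proof (intro equalityI UN_least)
      fix \<mu> :: real assume "\<mu> \<in> {0<..}"
      then obtain n where "inverse (Suc n) < \<mu>" using reals_Archimedean by auto
      then have "E \<mu> \<subseteq> E (inverse (Suc n))" by (intro le) auto
      then show "E \<mu> \<subseteq> (\<Union>n. E (inverse (Suc n)))" by blast
    next
      fix n show "E (inverse (Suc n)) \<subseteq> (\<Union>\<mu>\<in>{0<..}. E \<mu>)" by (rule UN_upper) simp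
    qed
    finally have B: "B = (\<Union>n. E (inverse (Suc n)))" .
    have "incseq (\<lambda>n. E (inverse (Suc n)))"
      by (rule incseq_SucI, rule le) (auto simp: field_simps)
    then have "(\<lambda>n. prob (E (inverse (Suc n)))) \<longlonglongrightarrow> prob B"
      unfolding B using EN by (intro finite_Lim_measure_incseq) auto
    then have "prob B \<le> \<alpha>" by (rule LIMSEQ_le_const2) (use EN in auto)
    then show ?thesis using B EN by auto
  qed
  then show "B \<in> sets P" "prob B \<le> \<alpha>" by auto
qed

section \<open>The integrated families and the sample mean\<close>

text \<open>A pointwise statement about one path \<open>\<omega>\<close>. A positive sample mean is
  itself an admissible \<open>\<mu>\<close>; a zero mean forces every observation up to
  \<open>k\<close> to vanish.\<close>

lemma lower_bound_less_sample_mean: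
  assumes p: "density_on_unit_interval p"
    and cont: "continuous_on {0<..} (\<lambda>\<mu>. M \<mu> k \<omega>)" and anti: "antimono_on {0<..} (\<lambda>\<mu>. M \<mu> k \<omega>)"
    and M: "\<And>\<mu>. 0 < \<mu> \<Longrightarrow> M \<mu> k \<omega> = integrated_decreasing Ts p \<mu> k \<omega>"
    and nonneg: "\<And>i. 1 \<le> i \<Longrightarrow> 0 \<le> Ts i \<omega>" and k: "1 \<le> k" and \<alpha>: "0 < \<alpha>" "\<alpha> < 1"
  shows "lower_bound M \<alpha> k \<omega> < ereal (sample_mean Ts k \<omega>)"
proof -
  have \<alpha>': "1 < 1 / \<alpha>" using \<alpha> by simp
  have sum: "(\<Sum>i=1..k. Ts i \<omega>) = sample_mean Ts k \<omega> * real k"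
    using k by (simp add: sample_mean_def)
  have "0 \<le> (\<Sum>i=1..k. Ts i \<omega>)" using nonneg by (intro sum_nonneg) auto
  then consider "0 < sample_mean Ts k \<omega>" | "sample_mean Ts k \<omega> = 0" "\<forall>i\<in>{1..k}. Ts i \<omega> = 0"
    using k nonneg sum_nonneg_eq_0_iff[of "{1..k}" "\<lambda>i. Ts i \<omega>"]
    by (auto simp: sample_mean_def less_le)
  then show ?thesis
  proof cases
    case 1
    have "M (sample_mean Ts k \<omega>) k \<omega> \<le> 1"
      unfolding M[OF 1] integrated_decreasing_def
      by (intro density_integral_le_one p prod_betting_le_one 1) (use nonneg sum in auto)
    then show ?thesis using \<alpha>' 1 by (simp add: lower_bound_less_pos_iff[where M = M, OF cont anti])
  next
    case 2
    \<comment> \<open>With vanishing observations each factor is \<open>1 - c\<close>, whatever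
      \<open>\<mu>\<close> is, so the level is never reached and the bound is
      \<open>-\<infinity>\<close>.\<close>
    have "M \<mu> k \<omega> \<le> 1" if "0 < \<mu>" for \<mu>
      unfolding M[OF that] integrated_decreasing_def
      by (intro density_integral_le_one p prod_le_1) (use 2 in auto)
    then show ?thesis using \<alpha>' 2 lower_bound_less_zero_iff[of M \<alpha> k \<omega>] by (force simp: zero_ereal_def)
  qed
qed

lemma integrated_increasing_reflect:
  "integrated_increasing Ts p (1 - \<mu>) k \<omega> = integrated_decreasing (\<lambda>i \<omega>. 1 - Ts i \<omega>) p \<mu> k \<omega>"
  by (simp add: integrated_increasing_def integrated_decreasing_def)

lemma sample_mean_reflect:
  "1 \<le> k \<Longrightarrow> sample_mean (\<lambda>i \<omega>. 1 - Ts i \<omega>) k \<omega> = 1 - sample_mean Ts k \<omega>"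
  by (simp add: sample_mean_def sum_subtractf diff_divide_distrib)

lemma less_one_minus_ereal_iff:
  "ereal a < 1 - x \<longleftrightarrow> x < ereal (1 - a)"
  by (cases x) (auto simp: one_ereal_def)

text \<open>Membership in a Borel set depends on the distribution only, and countably many null sets
  are discarded together.\<close>

lemma iid_sample_AE:
  assumes "prob_space P" "iid_sample P T Ts" "T \<in> borel_measurable P" "AE \<omega> in P. T \<omega> \<in> S"
    and S: "S \<in> sets borel"
  shows "AE \<omega> in P. \<forall>i\<ge>1. Ts i \<omega> \<in> S"
proof -
  interpret prob_space P by fact
  have "AE \<omega> in P. Ts i \<omega> \<in> S" if "1 \<le> i" for i
  proof -
    have m: "Ts i \<in> borel_measurable P" and d: "distr P borel (Ts i) = distr P borel T"
      using assms(2) that by (auto simp: iid_sample_def indep_vars_def)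
    have "AE x in distr P borel T. x \<in> S"
      using assms by (subst AE_distr_iff) auto
    then have "AE x in distr P borel (Ts i). x \<in> S" unfolding d .
    then show ?thesis using S by (subst (asm) AE_distr_iff[OF m]) auto
  qed
  then show ?thesis by (simp add: AE_all_countable)
qed

section \<open>Coverage and position of the sample mean\<close>

theorem theorem12:
  fixes P :: "'a measure" and F :: "nat \<Rightarrow> 'a measure"
    and T :: "'a \<Rightarrow> real" and Ts :: "nat \<Rightarrow> 'a \<Rightarrow> real"
    and M_minus M_plus :: "real \<Rightarrow> nat \<Rightarrow> 'a \<Rightarrow> real"
    and \<alpha>_minus \<alpha>_plus :: real
  assumes "prob_space P"
    and "T \<in> borel_measurable P" and "AE \<omega> in P. 0 \<le> T \<omega> \<and> T \<omega> \<le> 1"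
    and "iid_sample P T Ts"
    and "sample_filtration P F Ts"
    and "decreasing_test_family P F T M_minus"
    and "increasing_test_family P F T M_plus"
    and "\<forall>\<mu>>0. AE \<omega> in P. M_minus \<mu> 0 \<omega> = 1"
    and "\<forall>\<mu><1. AE \<omega> in P. M_plus \<mu> 0 \<omega> = 1"
    and "0 < \<alpha>_plus" and "\<alpha>_plus < 1" and "0 < \<alpha>_minus" and "\<alpha>_minus < 1"
  shows "(\<forall>k. confidence_interval P (1 - \<alpha>_plus - \<alpha>_minus)
            (\<lambda>\<omega>. {(MAX i\<in>{..k}. lower_bound M_minus \<alpha>_minus i \<omega>) <..<
                  (MIN i\<in>{..k}. upper_bound M_plus \<alpha>_plus i \<omega>)})
            (prob_space.expectation P T))
       \<and> (\<forall>p_minus p_plus.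
            density_on_unit_interval p_minus \<and> density_on_unit_interval p_plus \<and>
            (AE \<omega> in P. \<forall>k. \<forall>\<mu>>0. M_minus \<mu> k \<omega> = integrated_decreasing Ts p_minus \<mu> k \<omega>) \<and>
            (AE \<omega> in P. \<forall>k. \<forall>\<mu><1. M_plus \<mu> k \<omega> = integrated_increasing Ts p_plus \<mu> k \<omega>) \<longrightarrow>
            (AE \<omega> in P. \<forall>k\<ge>1. lower_bound M_minus \<alpha>_minus k \<omega> < ereal (sample_mean Ts k \<omega>) \<and>
                              ereal (sample_mean Ts k \<omega>) < upper_bound M_plus \<alpha>_plus k \<omega>))"
proof -
  interpret prob_space P by fact
  define m where "m = expectation T"
  define N_plus where "N_plus = (\<lambda>\<mu>. M_plus (1 - \<mu>))"
  have filt: "filtration (space P) F" and sub: "\<And>i. subalgebra P (F i)"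
    using assms(5) by (auto simp: sample_filtration_def)
  have "AE \<omega> in P. norm (T \<omega>) \<le> 1" using assms(3) by eventually_elim auto
  then have intT: "integrable P T"
    using assms(2) by (rule integrable_const_bound)
  have m0: "0 \<le> m" unfolding m_def using assms(3) by (intro integral_nonneg_AE) auto
  have "m \<le> expectation (\<lambda>_. 1)" unfolding m_def
    using assms(3) intT by (intro integral_mono_AE) auto
  then have m1: "m \<le> 1" by (simp add: prob_space)
  have ET': "expectation (\<lambda>\<omega>. 1 - T \<omega>) = 1 - m" using intT by (simp add: m_def prob_space)
  have famN: "decreasing_test_family P F (\<lambda>\<omega>. 1 - T \<omega>) N_plus"
    unfolding N_plus_def by (rule increasing_test_family_reflect) fact+
  have startN: "\<forall>\<mu>>0. AE \<omega> in P. N_plus \<mu> 0 \<omega> = 1" using assms(9) by (simp add: N_plus_def)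
  have upper: "upper_bound M_plus \<alpha>_plus k \<omega> = 1 - lower_bound N_plus \<alpha>_plus k \<omega>" for k \<omega>
    unfolding N_plus_def by (rule upper_bound_reflect)
  have "confidence_interval P (1 - \<alpha>_plus - \<alpha>_minus)
            (\<lambda>\<omega>. {(MAX i\<in>{..k}. lower_bound M_minus \<alpha>_minus i \<omega>) <..<
                  (MIN i\<in>{..k}. upper_bound M_plus \<alpha>_plus i \<omega>)}) m" for k
  proof -
    define L where "L = {\<omega> \<in> space P. \<exists>i\<le>k. ereal m \<le> lower_bound M_minus \<alpha>_minus i \<omega>}"
    \<comment> \<open>The miss of the upper bound, written as a miss of the lower bound of the
      reflected family, whose mean is \<open>1 - m\<close>.\<close>
    define U where "U = {\<omega> \<in> space P. \<exists>i\<le>k. ereal (1 - m) \<le> lower_bound N_plus \<alpha>_plus i \<omega>}"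
    note L = lower_noncoverage[where P = P and M = M_minus and T = T and k = k,
        OF \<open>prob_space P\<close> filt sub assms(6,8,12), folded m_def, OF m0, folded L_def]
    have "0 \<le> 1 - m" using m1 by simp
    note U = lower_noncoverage[where P = P and M = N_plus and T = "\<lambda>\<omega>. 1 - T \<omega>" and k = k,
        OF \<open>prob_space P\<close> filt sub famN startN assms(10), unfolded ET', OF this, folded U_def]
    \<comment> \<open>The maximum lies below \<open>m\<close> iff every lower bound does, and dually
      for the minimum, so coverage is the complement of the two misses.\<close>
    have eq: "{\<omega> \<in> space P. ereal m \<in> {(MAX i\<in>{..k}. lower_bound M_minus \<alpha>_minus i \<omega>) <..<
                  (MIN i\<in>{..k}. upper_bound M_plus \<alpha>_plus i \<omega>)}} = space P - (L \<union> U)"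
      by (auto simp: L_def U_def upper less_one_minus_ereal_iff not_less[symmetric])
    have "prob (L \<union> U) \<le> \<alpha>_minus + \<alpha>_plus"
      using measure_Un_le[OF L(1) U(1)] L(2) U(2) by simp
    then show ?thesis
      unfolding confidence_interval_def eq using L U by (simp add: prob_compl)
  qed
  moreover have "AE \<omega> in P. \<forall>k\<ge>1. lower_bound M_minus \<alpha>_minus k \<omega> < ereal (sample_mean Ts k \<omega>) \<and>
                              ereal (sample_mean Ts k \<omega>) < upper_bound M_plus \<alpha>_plus k \<omega>"
    if p: "density_on_unit_interval p_minus" "density_on_unit_interval p_plus"
      and M: "AE \<omega> in P. \<forall>k. \<forall>\<mu>>0. M_minus \<mu> k \<omega> = integrated_decreasing Ts p_minus \<mu> k \<omega>"
        "AE \<omega> in P. \<forall>k. \<forall>\<mu><1. M_plus \<mu> k \<omega> = integrated_increasing Ts p_plus \<mu> k \<omega>"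
    for p_minus p_plus
  proof -
    have "AE \<omega> in P. \<forall>i\<ge>1. Ts i \<omega> \<in> {0..1}"
      using assms(1-4) by (intro iid_sample_AE) auto
    \<comment> \<open>One null set serves all \<open>k\<close>. \<open>AE_space\<close> places
      \<open>\<omega>\<close> in the space, where continuity and monotonicity of the paths are
      given.\<close>
    with M AE_space show ?thesis
    proof eventually_elim
      case (elim \<omega>)
      show ?case
      proof (intro allI impI conjI)
        fix k :: nat assume k: "1 \<le> k"
        show "lower_bound M_minus \<alpha>_minus k \<omega> < ereal (sample_mean Ts k \<omega>)"
          using assms(6,12,13) elim k
          by (intro lower_bound_less_sample_mean[OF p(1)]) (auto simp: decreasing_test_family_def)
        have "lower_bound N_plus \<alpha>_plus k \<omega> < ereal (sample_mean (\<lambda>i \<omega>. 1 - Ts i \<omega>) k \<omega>)"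
          using famN assms(10,11) elim k
          by (intro lower_bound_less_sample_mean[OF p(2)])
            (auto simp: decreasing_test_family_def N_plus_def integrated_increasing_reflect)
        then show "ereal (sample_mean Ts k \<omega>) < upper_bound M_plus \<alpha>_plus k \<omega>"
          by (simp add: upper less_one_minus_ereal_iff sample_mean_reflect[OF k])
      qed
    qed
  qed
  ultimately show ?thesis unfolding m_def by blast
qed

end
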